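(* Let $X_{hh}$ be the substitutive $\mathbb Z^2$-subshift of the half-hex substitution. Then the normalizer semigroup $N(X_{hh},S)$ is a group and is isomorphic to a semidirect product between $\mathbb Z^2$ and $GL(2,\mathbb Z)$. Moreover, its automorphism group $\operatorname{Aut}(X_{hh},S)$ is trivial, i.e. $\operatorname{Aut}(X_{hh},S)=\{S^{\bm n}:{\bm n}\in\mathbb Z^2\}$.
   Context: The half-hex substitution $\zeta_{hh}$ has alphabet $\mathcal A=\{0,1,2\}$, expansion matrix $L=2\cdot\mathrm{Id}$ and support $F_1=\{(0,0),(1,0),(0,1),(1,-1)\}$: for each $a\in\mathcal A$, $\zeta_{hh}(a)_{(0,0)}=a$, $\zeta_{hh}(a)_{(1,0)}=2$, $\zeta_{hh}(a)_{(0,1)}=0$, $\zeta_{hh}(a)_{(1,-1)}=1$. Its iterates are $\zeta_{hh}^n:\mathcal A\to\mathcal A^{F_n}$, with $F_{n+1}=L(F_n)+F_1$, where a substitution acts by $\zeta(x)_{L({\bm j})+{\bm f}}=\zeta(x_{\bm j})_{\bm f}$, ${\bm f}\in F_1$. $X_{hh}$ is the set of all $x\in\mathcal A^{\mathbb Z^2}$ such that every finite pattern occurring in $x$ occurs (up to translation) in $\zeta_{hh}^n(a)$ for some $n>0$, $a\in\mathcal A$. The shift action is $S^{\bm n}(x)_{\bm k}=x_{{\bm n}+{\bm k}}$. For a system $(X,T,\mathbb Z^d)$ and $M\in GL(d,\mathbb Z)$, an $M$-endomorphism is a continuous surjective $\phi:X\to X$ with $\phi\circ T^{\bm n}=T^{M{\bm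 n}}\circ\phi$ for all ${\bm n}\in\mathbb Z^d$. $N(X,T)$ is the semigroup (under composition) of all $M$-endomorphisms for all $M\in GL(d,\mathbb Z)$. $\operatorname{Aut}(X,T)$ is the group of invertible $\mathrm{Id}$-endomorphisms. *)

theory Defs
  imports "HOL-Analysis.Analysis" "HOL-Algebra.Bij"
begin

section \<open>The normalizer semigroup of a topological system\<close>

text \<open>
  A system consists of a topology \<open>X\<close> (whose points are \<open>topspace X\<close>) and a map \<open>T\<close> giving for
  each \<open>n\<close> in \<open>int^'d\<close> a self-map of \<open>topspace X\<close>. Self-maps of the system are taken extensional
  (undefined outside \<open>topspace X\<close>), so that equality in HOL is equality as maps on \<open>topspace X\<close>;
  accordingly, composition is \<open>compose (topspace X)\<close>.
\<close>

definition M_endomorphism ::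
    "'x topology \<Rightarrow> (int^'d \<Rightarrow> 'x \<Rightarrow> 'x) \<Rightarrow> int^'d^'d \<Rightarrow> ('x \<Rightarrow> 'x) \<Rightarrow> bool" where
  "M_endomorphism X T M \<phi> \<longleftrightarrow>
     \<phi> \<in> extensional (topspace X) \<and>
     continuous_map X X \<phi> \<and>
     \<phi> ` topspace X = topspace X \<and>
     (\<forall>n. \<forall>x\<in>topspace X. \<phi> (T n x) = T (M *v n) (\<phi> x))"

definition normalizer_semigroup ::
    "'x topology \<Rightarrow> (int^'d \<Rightarrow> 'x \<Rightarrow> 'x) \<Rightarrow> ('x \<Rightarrow> 'x) monoid" where
  "normalizer_semigroup X T =
     \<lparr>carrier = {\<phi>. \<exists>M. invertible M \<and> M_endomorphism X T M \<phi>},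
      mult = compose (topspace X),
      one = (\<lambda>x\<in>topspace X. x)\<rparr>"

definition system_automorphisms ::
    "'x topology \<Rightarrow> (int^'d \<Rightarrow> 'x \<Rightarrow> 'x) \<Rightarrow> ('x \<Rightarrow> 'x) set" where
  "system_automorphisms X T =
     {\<phi>. M_endomorphism X T (mat 1) \<phi> \<and>
         (\<exists>\<psi>. M_endomorphism X T (mat 1) \<psi> \<and>
              compose (topspace X) \<psi> \<phi> = (\<lambda>x\<in>topspace X. x) \<and>
              compose (topspace X) \<phi> \<psi> = (\<lambda>x\<in>topspace X. x))}"


section \<open>Groups\<close>

definition int_vec_group :: "(int^'d) monoid" where
  "int_vec_group = \<lparr>carrier = UNIV, mult = (+), one = 0\<rparr>"

definition GL_int :: "(int^'d^'d) monoid" where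
  "GL_int = \<lparr>carrier = {A. invertible A}, mult = (**), one = mat 1\<rparr>"

text \<open>Outer semidirect product; meaningful for groups \<open>G\<close>, \<open>H\<close> and \<open>\<theta> \<in> hom H (AutoGroup G)\<close>.\<close>

definition semidirect_product ::
    "('a, 'c) monoid_scheme \<Rightarrow> ('b, 'd) monoid_scheme \<Rightarrow> ('b \<Rightarrow> 'a \<Rightarrow> 'a) \<Rightarrow> ('a \<times> 'b) monoid" where
  "semidirect_product G H \<theta> =
     \<lparr>carrier = carrier G \<times> carrier H,
      mult = (\<lambda>(g, h) (g', h'). (g \<otimes>\<^bsub>G\<^esub> \<theta> h g', h \<otimes>\<^bsub>H\<^esub> h')),
      one = (\<one>\<^bsub>G\<^esub>, \<one>\<^bsub>H\<^esub>)\<rparr>"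


section \<open>The half-hex substitution\<close>

definition hh_alphabet :: "nat set" where
  "hh_alphabet = {0, 1, 2}"

definition hh_L :: "int^2^2" where
  "hh_L = mat 2"

definition hh_support :: "(int^2) set" where
  "hh_support = {vector [0, 0], vector [1, 0], vector [0, 1], vector [1, -1]}"

text \<open>The value at \<open>f\<close> of the image of the letter \<open>a\<close>; only used for \<open>f \<in> hh_support\<close>.\<close>

definition hh_subst :: "nat \<Rightarrow> int^2 \<Rightarrow> nat" where
  "hh_subst a f =
     (if f = vector [0, 0] then a
      else if f = vector [1, 0] then 2
      else if f = vector [0, 1] then 0
      else 1)"

primrec hh_F :: "nat \<Rightarrow> (int^2) set" where
  "hh_F 0 = {0}"
| "hh_F (Suc n) = {hh_L *v j + f | j f. j \<in> hh_F n \<and> f \<in> hh_support}"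

text \<open>
  The iterate \<open>hh_iter n a\<close> is an element of \<open>hh_F n \<rightarrow>\<^sub>E hh_alphabet\<close>. The pair \<open>(j, f)\<close> below is the
  unique decomposition \<open>k = hh_L *v j + f\<close> with \<open>f \<in> hh_support\<close>; see \<open>hh_iter_Suc_apply\<close>.
\<close>

primrec hh_iter :: "nat \<Rightarrow> nat \<Rightarrow> int^2 \<Rightarrow> nat" where
  "hh_iter 0 a = (\<lambda>k\<in>hh_F 0. a)"
| "hh_iter (Suc n) a =
     (\<lambda>k\<in>hh_F (Suc n).
        let (j, f) = (THE (j, f). f \<in> hh_support \<and> k = hh_L *v j + f)
        in hh_subst (hh_iter n a j) f)"

lemma hh_decomposition_unique:
  assumes "f \<in> hh_support" "f' \<in> hh_support" "hh_L *v j + f = hh_L *v j' + f'"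
  shows "j = j' \<and> f = f'"
proof -
  have *: "2 * j$1 + f$1 = 2 * j'$1 + f'$1" "2 * j$2 + f$2 = 2 * j'$2 + f'$2"
    using arg_cong[OF assms(3), of "\<lambda>v. v$1"] arg_cong[OF assms(3), of "\<lambda>v. v$2"]
    by (simp_all add: hh_L_def matrix_vector_mult_def mat_def sum_2)
  have "f = f'"
    using assms(1,2) * unfolding hh_support_def by (auto simp: vec_eq_iff forall_2; presburger)
  with * show ?thesis by (simp add: vec_eq_iff forall_2)
qed

lemma hh_iter_Suc_apply:
  assumes "j \<in> hh_F n" "f \<in> hh_support"
  shows "hh_iter (Suc n) a (hh_L *v j + f) = hh_subst (hh_iter n a j) f"
proof -
  have "(THE (j', f'). f' \<in> hh_support \<and> hh_L *v j + f = hh_L *v j' + f') = (j, f)"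
    using assms(2) by (intro the_equality) (auto dest: hh_decomposition_unique)
  with assms show ?thesis by auto
qed


section \<open>The half-hex subshift\<close>

text \<open>The finite pattern of \<open>x\<close> on \<open>P\<close> occurs, up to translation by \<open>t\<close>, in some iterate.\<close>

definition X_hh :: "(int^2 \<Rightarrow> nat) set" where
  "X_hh = {x. range x \<subseteq> hh_alphabet \<and>
     (\<forall>P. finite P \<longrightarrow>
        (\<exists>n>0. \<exists>a\<in>hh_alphabet. \<exists>t. \<forall>p\<in>P. p + t \<in> hh_F n \<and> x p = hh_iter n a (p + t)))}"

definition hh_top :: "(int^2 \<Rightarrow> nat) topology" where
  "hh_top = subtopology (product_topology (\<lambda>_. discrete_topology hh_alphabet) UNIV) X_hh"

definition shift :: "int^2 \<Rightarrow> (int^2 \<Rightarrow> nat) \<Rightarrow> int^2 \<Rightarrow> nat" where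
  "shift n x = (\<lambda>k. x (n + k))"

lemma topspace_hh_top: "topspace hh_top = X_hh"
  by (auto simp: hh_top_def X_hh_def PiE_def)

end

theory Submission
  imports Defs
begin

text \<open>
  For an integer vector \<open>w \<noteq> 0\<close> write \<open>w = 2 ^ m *s u\<close> with \<open>u\<close> odd, that is, with some odd
  coordinate. The class of \<open>u\<close> modulo 2 is one of the three nonzero vectors over the field with two
  elements, and the half-hex letters name these three classes. Call this letter \<open>toeplitz w\<close>.
  By induction, every iterate of the substitution is a piece of the array \<open>toeplitz\<close>, except that
  the letter at the origin, where \<open>toeplitz\<close> has no meaning, is the seed (\<open>hh_iter_eq\<close>). The
  supports contain arbitrarily large balls, so the subshift consists of the limits of translates of
  \<open>toeplitz\<close> (\<open>X_hh_iff_toeplitz_patterns\<close>).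

  The group \<open>GL(2, \<int>)\<close> preserves powers of two and oddness and permutes the classes modulo 2, so
  \<open>toeplitz (M *v w)\<close> depends only on \<open>M\<close> and \<open>toeplitz w\<close>. Moving cells by \<open>M\<close> and permuting the
  letters accordingly is therefore a symmetry of the subshift for every \<open>M\<close>; combined with the
  shifts this gives an action of the affine group, the semidirect product of \<open>\<int>\<^sup>2\<close> and \<open>GL(2, \<int>)\<close> (\<open>affine_map\<close>).

  No other endomorphism exists. Composing an \<open>M\<close>-endomorphism with the symmetry for the inverse of
  \<open>M\<close> leaves an \<open>Id\<close>-endomorphism \<open>\<phi>\<close>, and \<open>Id_endomorphism_is_shift\<close> shows that \<open>\<phi>\<close> is a shift.
  Each point \<open>x\<close> has, for each \<open>n\<close>, an address \<open>z\<close> modulo \<open>2 ^ n\<close>: away from the cells \<open>k\<close> with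
  \<open>k + z\<close> divisible by \<open>2 ^ n\<close> it agrees with \<open>toeplitz\<close> translated by \<open>z\<close>. Together the addresses
  form a factor map onto the pairs of 2-adic integers. Since orbits are dense, \<open>\<phi>\<close> acts on this factor
  as translation by some \<open>d\<close>. A fibre has more than one point only over an integer vector \<open>-k\<close>, where
  the letter at the single cell \<open>k\<close> is free. Surjectivity of \<open>\<phi>\<close> gives distinct preimages for the
  points over \<open>0\<close>, and they all lie over \<open>-d\<close>; so \<open>d\<close> is an integer vector. Composed with the shift
  by \<open>-d\<close>, the map \<open>\<phi>\<close> preserves addresses, so it changes a point at most at its exceptional cell. As
  each point is a limit of points whose exceptional cells avoid a given cell, continuity shows that
  nothing changes at all, and \<open>\<phi>\<close> is the shift by \<open>d\<close>.

  Finally the affine action is faithful, because the shift acts freely (\<open>affine_map_inject\<close>). The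
  normalizer is therefore isomorphic to the affine group (\<open>affine_iso\<close>), in particular a group, and
  its elements with trivial linear part are the shifts.
\<close>


section \<open>Divisibility of integer vectors by powers of two\<close>

definition pow2_dvd :: "nat \<Rightarrow> int^'d \<Rightarrow> bool" where
  "pow2_dvd n w \<longleftrightarrow> (\<forall>i. 2 ^ n dvd w $ i)"

lemma pow2_dvd_0 [simp]: "pow2_dvd 0 w"
  by (simp add: pow2_dvd_def)

lemma pow2_dvd_zero [simp]: "pow2_dvd n 0"
  by (simp add: pow2_dvd_def)

lemma pow2_dvd_scale_iff: "pow2_dvd (n + m) (2 ^ m *s u) \<longleftrightarrow> pow2_dvd n u"
  by (simp add: pow2_dvd_def power_add)

lemma pow2_dvd_scale [simp]: "pow2_dvd n (2 ^ n *s u)"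
  by (simp add: pow2_dvd_def)

lemma pow2_dvd_mono: "pow2_dvd n w \<Longrightarrow> m \<le> n \<Longrightarrow> pow2_dvd m w"
  using le_imp_power_dvd dvd_trans unfolding pow2_dvd_def by blast

lemma pow2_dvd_add: "pow2_dvd n v \<Longrightarrow> pow2_dvd n w \<Longrightarrow> pow2_dvd n (v + w)"
  by (simp add: pow2_dvd_def)

lemma pow2_dvd_diff: "pow2_dvd n v \<Longrightarrow> pow2_dvd n w \<Longrightarrow> pow2_dvd n (v - w)"
  by (simp add: pow2_dvd_def)

lemma pow2_dvd_add_iff: "pow2_dvd n d \<Longrightarrow> pow2_dvd n (w + d) \<longleftrightarrow> pow2_dvd n w"
  using pow2_dvd_add[of n w d] pow2_dvd_diff[of n "w + d" d] by auto

lemma pow2_dvd_imp_scale: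
  assumes "pow2_dvd n w" obtains u where "w = 2 ^ n *s u"
proof
  show "w = 2 ^ n *s (\<chi> i. w $ i div 2 ^ n)"
    using assms by (simp add: pow2_dvd_def vec_eq_iff)
qed

lemma not_pow2_dvd_large:
  assumes "\<bar>w $ i\<bar> < int n" "w $ i \<noteq> 0" shows "\<not> pow2_dvd n w"
proof
  assume "pow2_dvd n w"
  then have "2 ^ n \<le> \<bar>w $ i\<bar>"
    using assms by (auto simp: pow2_dvd_def intro: zdvd_imp_le)
  moreover have "int n < 2 ^ n"
    by (metis of_nat_less_iff of_nat_less_numeral_power_cancel_iff less_exp)
  ultimately show False using assms by simp
qed

text \<open>
  No nonzero vector is divisible by all powers of two. For finitely many vectors one exponent serves,
  which turns the conditions \<open>w \<noteq> 0\<close> into congruence conditions.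
\<close>

lemma finite_nonzero_not_pow2_dvd:
  fixes W :: "(int^'d) set"
  assumes "finite W" "0 \<notin> W"
  obtains N where "\<And>w n. w \<in> W \<Longrightarrow> N \<le> n \<Longrightarrow> \<not> pow2_dvd n w"
proof -
  have "\<exists>N. \<forall>w\<in>W. \<not> pow2_dvd N w"
    using assms
  proof (induction W)
    case (insert w W)
    then obtain N where N: "\<forall>w\<in>W. \<not> pow2_dvd N w" by auto
    obtain i where i: "w $ i \<noteq> 0" using insert by (auto simp: vec_eq_iff)
    define N' where "N' = max N (nat (\<bar>w $ i\<bar> + 1))"
    have "\<not> pow2_dvd N' w"
      by (rule not_pow2_dvd_large[of w i]) (use i in \<open>auto simp: N'_def\<close>)
    moreover have "\<forall>w\<in>W. \<not> pow2_dvd N' w"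
      using N pow2_dvd_mono[of N' _ N] by (auto simp: N'_def)
    ultimately show ?case by blast
  qed auto
  then show ?thesis using that pow2_dvd_mono by metis
qed

lemma zero_if_all_pow2_dvd:
  assumes "\<And>n. pow2_dvd n w" shows "w = 0"
  by (rule ccontr, rule finite_nonzero_not_pow2_dvd[of "{w}"]) (use assms in auto)

lemma odd_part_exists:
  fixes w :: "int^'d"
  assumes "\<not> pow2_dvd n w"
  obtains m u where "m < n" "w = 2 ^ m *s u" "\<not> pow2_dvd 1 u"
proof -
  define m where "m = (LEAST m. \<not> pow2_dvd (Suc m) w)"
  have ex: "\<not> pow2_dvd (Suc (n - 1)) w"
    using assms by (cases n) auto
  have m: "\<not> pow2_dvd (Suc m) w"
    unfolding m_def using ex by (rule LeastI)
  have "pow2_dvd m w"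
  proof (cases m)
    case (Suc k)
    then show ?thesis using not_less_Least[of k "\<lambda>m. \<not> pow2_dvd (Suc m) w"] by (auto simp: m_def)
  qed auto
  then obtain u where u: "w = 2 ^ m *s u" by (rule pow2_dvd_imp_scale)
  have "m < n" using \<open>pow2_dvd m w\<close> assms pow2_dvd_mono by (metis not_less)
  moreover have "\<not> pow2_dvd 1 u" using m u pow2_dvd_scale_iff[of 1 m u] by auto
  ultimately show ?thesis using that u by blast
qed

lemma odd_part_unique:
  fixes u v :: "int^'d"
  assumes "2 ^ m *s u = 2 ^ k *s v" "\<not> pow2_dvd 1 u" "\<not> pow2_dvd 1 v"
  shows "u = v"
proof -
  have "m \<ge> k" if "2 ^ m *s u = 2 ^ k *s v" "\<not> pow2_dvd 1 u" for m k and u v :: "int^'d"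
  proof (rule ccontr)
    assume "\<not> m \<ge> k"
    then have "pow2_dvd (1 + m) (2 ^ m *s u)"
      unfolding that(1) using pow2_dvd_mono[of k "2 ^ k *s v" "1 + m"] by simp
    then show False using that pow2_dvd_scale_iff[of 1 m u] by simp
  qed
  from this[OF assms(1,2)] this[OF assms(1)[symmetric] assms(3)] have "m = k" by simp
  with assms(1) show ?thesis by (simp add: vec_eq_iff)
qed

lemma bounded_representative:
  fixes z :: "int^'d"
  obtains z' where "z' \<in> {z. \<forall>i. 0 \<le> z $ i \<and> z $ i < 2 ^ n}" "pow2_dvd n (z - z')"
proof
  show "(\<chi> i. z $ i mod 2 ^ n) \<in> {z. \<forall>i. 0 \<le> z $ i \<and> z $ i < 2 ^ n}" by simp
  show "pow2_dvd n (z - (\<chi> i. z $ i mod 2 ^ n))"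
    by (simp add: pow2_dvd_def mod_eq_dvd_iff[symmetric])
qed

lemma finite_box: "finite {z :: int^'d. \<forall>i. 0 \<le> z $ i \<and> z $ i < 2 ^ n}"
proof -
  have "{z :: int^'d. \<forall>i. 0 \<le> z $ i \<and> z $ i < 2 ^ n} \<subseteq> vec_lambda ` (UNIV \<rightarrow>\<^sub>E {0..<2 ^ n})"
  proof
    fix z :: "int^'d" assume "z \<in> {z. \<forall>i. 0 \<le> z $ i \<and> z $ i < 2 ^ n}"
    then have "vec_nth z \<in> UNIV \<rightarrow>\<^sub>E {0..<2 ^ n}" by auto
    then show "z \<in> vec_lambda ` (UNIV \<rightarrow>\<^sub>E {0..<2 ^ n})" by (metis image_eqI vec_nth_inverse)
  qed
  then show ?thesis by (rule finite_subset) (auto intro!: finite_imageI finite_PiE)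
qed

lemma matrix_vector_mult_scale:
  fixes M :: "int^'d^'e"
  shows "M *v (c *s u) = c *s (M *v u)"
  by (simp add: matrix_vector_mult_def vec_eq_iff sum_distrib_left ac_simps)

lemma pow2_dvd_matrix: "pow2_dvd n w \<Longrightarrow> pow2_dvd n (M *v w)"
  by (metis matrix_vector_mult_scale pow2_dvd_imp_scale pow2_dvd_scale)

lemma matrix_inv_inverse:
  fixes M :: "'a::semiring_1^'n^'m"
  assumes "invertible M"
  shows "M ** matrix_inv M = mat 1" "matrix_inv M ** M = mat 1"
  using someI_ex[of "\<lambda>A'. M ** A' = mat 1 \<and> A' ** M = mat 1"] assms
  unfolding invertible_def matrix_inv_def by auto

lemma matrix_inv_vector [simp]:
  fixes M :: "'a::comm_semiring_1^'n^'n"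
  assumes "invertible M"
  shows "M *v (matrix_inv M *v w) = w" "matrix_inv M *v (M *v w) = w"
  using matrix_inv_inverse[OF assms] by (simp_all add: matrix_vector_mul_assoc)

lemma pow2_dvd_matrix_iff [simp]:
  "invertible M \<Longrightarrow> pow2_dvd n (M *v w) \<longleftrightarrow> pow2_dvd n w" for M :: "int^'d^'d"
  by (metis matrix_inv_vector(2) pow2_dvd_matrix)

lemma matrix_eq_zero_iff [simp]:
  "invertible M \<Longrightarrow> M *v w = 0 \<longleftrightarrow> w = 0" for M :: "int^'d^'d"
  by (metis matrix_inv_vector(2) matrix_vector_mult_0_right)


section \<open>The Toeplitz array of directions modulo two\<close>

text \<open>
  The letters name the three nonzero vectors of the plane over the field with two elements; which
  letter names which vector is dictated by the substitution, whose image of any letter carries these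
  names at the three odd cells of its support.
\<close>

definition parity_letter :: "int^2 \<Rightarrow> nat" where
  "parity_letter u = (if even (u $ 1) then 0 else if even (u $ 2) then 2 else 1)"

definition letter_vec :: "nat \<Rightarrow> int^2" where
  "letter_vec a = (if a = 0 then vector [0, 1] else if a = 2 then vector [1, 0] else vector [1, 1])"

text \<open>
  The letter is the lowest nonzero 2-adic digit of \<open>w\<close>. The origin has no odd part, and the value there is
  a meaningless default.
\<close>

definition toeplitz :: "int^2 \<Rightarrow> nat" where
  "toeplitz w = parity_letter (THE u. \<not> pow2_dvd 1 u \<and> (\<exists>m. w = 2 ^ m *s u))"

lemma toeplitz_scale_odd:
  assumes "\<not> pow2_dvd 1 u"
  shows "toeplitz (2 ^ m *s u) = parity_letter u"
proof -
  have "(THE v. \<not> pow2_dvd 1 v \<and> (\<exists>k. 2 ^ m *s u = 2 ^ k *s v)) = u"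
    using assms odd_part_unique by (intro the_equality) blast+
  then show ?thesis by (simp add: toeplitz_def)
qed

lemma toeplitz_odd: "\<not> pow2_dvd 1 u \<Longrightarrow> toeplitz u = parity_letter u"
  using toeplitz_scale_odd[of u 0] by simp

lemma zero_in_alphabet [simp]: "0 \<in> hh_alphabet" and one_in_alphabet [simp]: "1 \<in> hh_alphabet"
  by (simp_all add: hh_alphabet_def)

lemma parity_letter_in_alphabet [simp]: "parity_letter u \<in> hh_alphabet"
  by (simp add: parity_letter_def hh_alphabet_def)

lemma toeplitz_in_alphabet [simp]: "toeplitz u \<in> hh_alphabet"
  by (simp add: toeplitz_def)

lemma letter_vec_odd [simp]: "\<not> pow2_dvd (Suc 0) (letter_vec a)"
  by (auto simp: pow2_dvd_def letter_vec_def forall_2)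

lemma parity_letter_letter_vec [simp]: "a \<in> hh_alphabet \<Longrightarrow> parity_letter (letter_vec a) = a"
  by (auto simp: parity_letter_def letter_vec_def hh_alphabet_def)

lemma parity_letter_eq_iff:
  assumes "\<not> pow2_dvd 1 u" "\<not> pow2_dvd 1 v"
  shows "parity_letter u = parity_letter v \<longleftrightarrow> pow2_dvd 1 (u - v)"
  using assms by (auto simp: pow2_dvd_def parity_letter_def forall_2)

text \<open>
  The letter depends only on the lowest nonzero binary digits of \<open>w\<close>, which is the Toeplitz property
  of the array.
\<close>

lemma toeplitz_cong:
  assumes "\<not> pow2_dvd n w" "pow2_dvd n (w - w')"
  shows "toeplitz w' = toeplitz w"
proof -
  obtain m u where mu: "m < n" "w = 2 ^ m *s u" "\<not> pow2_dvd 1 u"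
    using assms(1) by (rule odd_part_exists)
  obtain d where d: "w - w' = 2 ^ n *s d" using assms(2) by (rule pow2_dvd_imp_scale)
  define u' where "u' = u - 2 ^ (n - m) *s d"
  have "w' = w - (w - w')" by simp
  also have "\<dots> = 2 ^ m *s u - 2 ^ (m + (n - m)) *s d" using mu d by simp
  also have "\<dots> = 2 ^ m *s u'"
    unfolding u'_def power_add by (simp add: vec_eq_iff algebra_simps)
  finally have w': "w' = 2 ^ m *s u'" .
  have "pow2_dvd (n - m) (u - u')" by (simp add: u'_def)
  then have *: "pow2_dvd 1 (u - u')" by (rule pow2_dvd_mono) (use mu in simp)
  then have "\<not> pow2_dvd 1 u'" using mu(3) pow2_dvd_add by fastforce
  with * mu(3) have "parity_letter u = parity_letter u'" by (simp add: parity_letter_eq_iff)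
  with \<open>\<not> pow2_dvd 1 u'\<close> mu w' show ?thesis by (simp add: toeplitz_scale_odd)
qed

lemma toeplitz_double:
  assumes "w \<noteq> 0" shows "toeplitz (2 *s w) = toeplitz w"
proof -
  obtain n where "\<not> pow2_dvd n w" using assms zero_if_all_pow2_dvd by blast
  then obtain m u where "w = 2 ^ m *s u" "\<not> pow2_dvd 1 u" by (rule odd_part_exists)
  then show ?thesis
    using toeplitz_scale_odd[of u m] toeplitz_scale_odd[of u "Suc m"] by (simp add: vector_smult_assoc)
qed

text \<open>
  The array has no periods beyond the evident ones: if \<open>z - z'\<close> is \<open>2 ^ m\<close> times an odd vector \<open>d\<close>, then
  at a cell where one translate sees \<open>2 ^ m\<close> times an odd vector of a class other than that of \<open>d\<close>,
  the other translate sees the third class.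
\<close>

lemma toeplitz_separates:
  assumes "\<not> pow2_dvd n (z - z')"
  obtains k where "\<not> pow2_dvd n (k + z)" "\<not> pow2_dvd n (k + z')"
    "toeplitz (k + z) \<noteq> toeplitz (k + z')"
proof -
  obtain m d where d: "m < n" "z - z' = 2 ^ m *s d" "\<not> pow2_dvd 1 d"
    using assms by (rule odd_part_exists)
  define u :: "int^2" where "u = (if even (d $ 1) then vector [1, 0] else vector [0, 1])"
  \<comment> \<open>\<open>u\<close> and \<open>u - d\<close> represent the two nonzero classes modulo 2 other than that of \<open>d\<close>.\<close>
  have u: "\<not> pow2_dvd 1 u" "\<not> pow2_dvd 1 (u - d)" "\<not> pow2_dvd 1 d"
    using d(3) by (auto simp: u_def pow2_dvd_def forall_2)
  have *: "\<not> pow2_dvd n (2 ^ m *s v)" if "\<not> pow2_dvd 1 v" for v :: "int^2"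
    using that pow2_dvd_scale_iff[of 1 m v] pow2_dvd_mono[of n _ "1 + m"] d(1) by auto
  define k where "k = 2 ^ m *s u - z"
  have k: "k + z = 2 ^ m *s u" "k + z' = 2 ^ m *s (u - d)"
    using d(2) by (auto simp: k_def vec_eq_iff algebra_simps)
  have "toeplitz (k + z) \<noteq> toeplitz (k + z')"
    unfolding k toeplitz_scale_odd[OF u(1)] toeplitz_scale_odd[OF u(2)]
    using u by (simp add: parity_letter_eq_iff)
  with *[OF u(1)] *[OF u(2)] show ?thesis unfolding k[symmetric] by (rule that)
qed


section \<open>The half-hex subshift as the orbit closure of the Toeplitz array\<close>

lemma hh_L_mult: "hh_L *v j = 2 *s j"
  by (simp add: hh_L_def matrix_vector_mult_def mat_def vec_eq_iff sum_2 forall_2)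

text \<open>
  In the coordinates \<open>k $ 1\<close> and \<open>k $ 1 + k $ 2\<close> the four digits in \<open>hh_support\<close> become all pairs of
  binary digits, so each element of \<open>hh_F n\<close> is a pair of binary expansions of length \<open>n\<close>.
\<close>

lemma hh_F_eq:
  "hh_F n = {k. 0 \<le> k $ 1 \<and> k $ 1 < 2 ^ n \<and> 0 \<le> k $ 1 + k $ 2 \<and> k $ 1 + k $ 2 < 2 ^ n}"
proof (induction n)
  case 0
  then show ?case by (auto simp: vec_eq_iff forall_2)
next
  case (Suc n)
  show ?case
  proof (intro Set.set_eqI iffI)
    fix k assume "k \<in> hh_F (Suc n)"
    then obtain j f where "j \<in> hh_F n" "f \<in> hh_support" "k = 2 *s j + f"
      by (auto simp: hh_L_mult)
    then show "k \<in> {k. 0 \<le> k $ 1 \<and> k $ 1 < 2 ^ Suc n \<and> 0 \<le> k $ 1 + k $ 2 \<and> k $ 1 + k $ 2 < 2 ^ Suc n}"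
      unfolding Suc.IH hh_support_def by auto
  next
    fix k :: "int^2"
    assume k: "k \<in> {k. 0 \<le> k $ 1 \<and> k $ 1 < 2 ^ Suc n \<and> 0 \<le> k $ 1 + k $ 2 \<and> k $ 1 + k $ 2 < 2 ^ Suc n}"
    define j :: "int^2" where "j = vector [k $ 1 div 2, (k $ 1 + k $ 2) div 2 - k $ 1 div 2]"
    define f :: "int^2" where "f = vector [k $ 1 mod 2, (k $ 1 + k $ 2) mod 2 - k $ 1 mod 2]"
    have "j \<in> hh_F n" using k unfolding Suc.IH j_def by auto
    moreover have "f \<in> hh_support"
    proof -
      have "k $ 1 mod 2 = 0 \<or> k $ 1 mod 2 = 1" "(k $ 1 + k $ 2) mod 2 = 0 \<or> (k $ 1 + k $ 2) mod 2 = 1"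
        by presburger+
      then show ?thesis unfolding f_def hh_support_def by auto
    qed
    moreover have "k = 2 *s j + f"
      unfolding vec_eq_iff forall_2 j_def f_def by (simp; presburger)
    ultimately show "k \<in> hh_F (Suc n)" by (auto simp: hh_L_mult)
  qed
qed

text \<open>
  These are the fixed points of the substitution, with seed \<open>a\<close> at the origin.
\<close>

definition fixed_point :: "nat \<Rightarrow> int^2 \<Rightarrow> nat" where
  "fixed_point a = toeplitz(0 := a)"

text \<open>
  The seed does not show in finite patterns: a translation by \<open>2 ^ N *s u\<close>, with \<open>N\<close> large, \<open>u\<close> odd and
  of class \<open>a\<close>, leaves \<open>toeplitz\<close> unchanged on the other cells of \<open>P\<close> and carries the origin to a cell with
  letter \<open>a\<close>.
\<close>

lemma fixed_point_pattern:
  assumes "a \<in> hh_alphabet" "finite P"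
  obtains s where "\<And>p. p \<in> P \<Longrightarrow> p + s \<noteq> 0" "\<And>p. p \<in> P \<Longrightarrow> fixed_point a p = toeplitz (p + s)"
proof -
  obtain N where N: "\<And>w n. w \<in> P - {0} \<Longrightarrow> N \<le> n \<Longrightarrow> \<not> pow2_dvd n w"
    by (rule finite_nonzero_not_pow2_dvd[of "P - {0}"]) (use assms in auto)
  define s where "s = 2 ^ N *s letter_vec a"
  have s: "\<not> pow2_dvd (1 + N) s" "pow2_dvd N s"
    unfolding s_def pow2_dvd_scale_iff by simp_all
  have "p + s \<noteq> 0 \<and> fixed_point a p = toeplitz (p + s)" if "p \<in> P" for p
  proof (cases "p = 0")
    case True
    moreover have "toeplitz s = a" unfolding s_def using assms by (simp add: toeplitz_scale_odd)
    moreover have "s \<noteq> 0" using s(1) by auto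
    ultimately show ?thesis by (simp add: fixed_point_def)
  next
    case False
    then have d: "\<not> pow2_dvd N p" using N that by auto
    have "toeplitz (p + s) = toeplitz p"
      by (rule toeplitz_cong[OF d]) (use s(2) pow2_dvd_diff[of N 0 s] in simp)
    moreover have "\<not> pow2_dvd N (p + s)" using d s(2) by (simp add: pow2_dvd_add_iff)
    ultimately show ?thesis using False by (auto simp: fixed_point_def)
  qed
  then show ?thesis using that by blast
qed

text \<open>
  Of the four digits, \<open>0\<close> doubles the position and copies the letter, while the other three lead to
  odd positions and produce precisely the letter of the class of that position.
\<close>

lemma hh_iter_eq:
  assumes "k \<in> hh_F n"
  shows "hh_iter n a k = fixed_point a k"
  using assms
proof (induction n arbitrary: k)
  case (Suc n)
  then obtain j f where jf: "j \<in> hh_F n" "f \<in> hh_support" "k = hh_L *v j + f" by auto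
  have it: "hh_iter (Suc n) a k = hh_subst (fixed_point a j) f"
    unfolding jf(3) hh_iter_Suc_apply[OF jf(1,2)] Suc.IH[OF jf(1)] ..
  show ?case
  proof (cases "f = 0")
    case True
    moreover have "vector [0, 0] = (0 :: int^2)" by (simp add: vec_eq_iff forall_2)
    moreover have "2 *s j = 0 \<longleftrightarrow> j = 0" by (simp add: vec_eq_iff)
    ultimately show ?thesis
      using it toeplitz_double[of j] by (simp add: jf(3) hh_L_mult hh_subst_def fixed_point_def del: hh_iter.simps)
  next
    case False
    then have k: "\<not> pow2_dvd 1 k"
      using jf(2) by (auto simp: jf(3) hh_L_mult hh_support_def pow2_dvd_def forall_2 vec_eq_iff)
    have "hh_subst b f = parity_letter k" for b
      using jf(2) False
      by (auto simp: jf(3) hh_L_mult hh_support_def hh_subst_def parity_letter_def forall_2 vec_eq_iff)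
    moreover have "k \<noteq> 0" using k by auto
    ultimately show ?thesis using it toeplitz_odd[OF k] by (simp add: fixed_point_def del: hh_iter.simps)
  qed
qed (simp add: fixed_point_def)

text \<open>
  The parallelogram \<open>hh_F n\<close> has the origin as a vertex, so a finite set fits inside only
  after a translation. Multiples of \<open>2 ^ N\<close> suffice, and for large \<open>N\<close> these do not disturb \<open>toeplitz\<close>.
\<close>

lemma finite_translate_into_hh_F:
  fixes W :: "(int^2) set"
  assumes "finite W"
  obtains v n where "n > 0" "\<And>w. w \<in> W \<Longrightarrow> w + 2 ^ N *s v \<in> hh_F n"
proof -
  define B where "B = (\<Sum>w\<in>W. \<bar>w $ 1\<bar> + \<bar>w $ 2\<bar>)"
  have B: "\<bar>w $ 1\<bar> + \<bar>w $ 2\<bar> \<le> B" if "w \<in> W" for w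
    unfolding B_def using member_le_sum[OF that, of "\<lambda>w. \<bar>w $ 1\<bar> + \<bar>w $ 2\<bar>"] assms by simp
  have B0: "B \<ge> 0" unfolding B_def by (rule sum_nonneg) simp
  \<comment> \<open>The translation vector is \<open>(2 ^ N * B, 0)\<close>; it raises both coordinates of the parallelogram by
    at least \<open>B\<close>.\<close>
  define s where "s = 2 ^ N * B"
  have s: "B \<le> s" unfolding s_def using mult_right_mono[of 1 "2 ^ N" B] B0 by simp
  define n where "n = nat (B + s + 1)"
  have "int n < 2 ^ n"
    by (metis of_nat_less_iff of_nat_less_numeral_power_cancel_iff less_exp)
  then have n: "B + s < 2 ^ n" using B0 s by (simp add: n_def)
  show ?thesis
  proof
    show "n > 0" using B0 s by (simp add: n_def)
    fix w assume w: "w \<in> W"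
    have "(2 ^ N *s vector [B, 0] :: int^2) $ 1 = s" "(2 ^ N *s vector [B, 0] :: int^2) $ 2 = 0"
      by (simp_all add: s_def)
    then show "w + 2 ^ N *s vector [B, 0] \<in> hh_F n"
      using B[OF w] s n unfolding hh_F_eq by auto
  qed
qed

text \<open>
  This frees the subshift of the substitution: its language is that of the array \<open>toeplitz\<close>, read away
  from the origin. Patterns of iterates that meet the origin are moved away from it by
  \<open>fixed_point_pattern\<close>; conversely, a pattern of \<open>toeplitz\<close> is pushed into some \<open>hh_F n\<close> by
  \<open>finite_translate_into_hh_F\<close>.
\<close>

lemma X_hh_iff_toeplitz_patterns:
  "x \<in> X_hh \<longleftrightarrow> range x \<subseteq> hh_alphabet \<and>
     (\<forall>P. finite P \<longrightarrow> (\<exists>t. \<forall>p\<in>P. p + t \<noteq> 0 \<and> x p = toeplitz (p + t)))"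
  (is "_ \<longleftrightarrow> _ \<and> (\<forall>P. finite P \<longrightarrow> ?pat P)")
proof (intro iffI conjI allI impI)
  assume x: "x \<in> X_hh"
  then show "range x \<subseteq> hh_alphabet" by (simp add: X_hh_def)
  fix P :: "(int^2) set" assume P: "finite P"
  have "\<exists>n>0. \<exists>a\<in>hh_alphabet. \<exists>t. \<forall>p\<in>P. p + t \<in> hh_F n \<and> x p = hh_iter n a (p + t)"
    using x P by (simp add: X_hh_def)
  then obtain n a t where nat: "a \<in> hh_alphabet"
    "\<And>p. p \<in> P \<Longrightarrow> p + t \<in> hh_F n \<and> x p = hh_iter n a (p + t)"
    by blast
  have xp: "x p = fixed_point a (p + t)" if "p \<in> P" for p
    using nat(2)[OF that] hh_iter_eq by metis
  have "finite ((\<lambda>p. p + t) ` P)" using P by simp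
  then obtain s where s: "\<And>w. w \<in> (\<lambda>p. p + t) ` P \<Longrightarrow> w + s \<noteq> 0"
    "\<And>w. w \<in> (\<lambda>p. p + t) ` P \<Longrightarrow> fixed_point a w = toeplitz (w + s)"
    using fixed_point_pattern[OF nat(1)] by metis
  have "p + (t + s) \<noteq> 0 \<and> x p = toeplitz (p + (t + s))" if "p \<in> P" for p
    using s[of "p + t"] xp[OF that] that by (simp add: add.assoc)
  then show "?pat P" by blast
next
  assume x: "range x \<subseteq> hh_alphabet \<and> (\<forall>P. finite P \<longrightarrow> ?pat P)"
  show "x \<in> X_hh" unfolding X_hh_def
  proof (intro CollectI conjI allI impI)
    show "range x \<subseteq> hh_alphabet" using x by simp
    fix P :: "(int^2) set" assume P: "finite P"
    then obtain t where t: "\<And>p. p \<in> P \<Longrightarrow> p + t \<noteq> 0 \<and> x p = toeplitz (p + t)" using x by blast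
    obtain N where N: "\<And>w n. w \<in> (\<lambda>p. p + t) ` P \<Longrightarrow> N \<le> n \<Longrightarrow> \<not> pow2_dvd n w"
      by (rule finite_nonzero_not_pow2_dvd[of "(\<lambda>p. p + t) ` P"]) (use P t in auto)
    obtain v n where n: "n > 0" "\<And>w. w \<in> (\<lambda>p. p + t) ` P \<Longrightarrow> w + 2 ^ N *s v \<in> hh_F n"
      by (rule finite_translate_into_hh_F[of "(\<lambda>p. p + t) ` P" N]) (use P in auto)
    have "p + (t + 2 ^ N *s v) \<in> hh_F n \<and> x p = hh_iter n 0 (p + (t + 2 ^ N *s v))" if p: "p \<in> P" for p
    proof -
      define w where "w = p + t + 2 ^ N *s v"
      have F: "w \<in> hh_F n" using n(2) p by (auto simp: w_def)
      have d: "\<not> pow2_dvd N (p + t)" using N p by auto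
      then have "\<not> pow2_dvd N w" unfolding w_def by (simp add: pow2_dvd_add_iff)
      then have "w \<noteq> 0" by auto
      moreover have "toeplitz w = toeplitz (p + t)"
        by (rule toeplitz_cong[OF d]) (use pow2_dvd_diff[of N 0 "2 ^ N *s v"] in \<open>simp add: w_def\<close>)
      ultimately show ?thesis using F hh_iter_eq[OF F] t[OF p] by (simp add: fixed_point_def w_def add.assoc)
    qed
    then show "\<exists>n>0. \<exists>a\<in>hh_alphabet. \<exists>t. \<forall>p\<in>P. p + t \<in> hh_F n \<and> x p = hh_iter n a (p + t)"
      using n(1) zero_in_alphabet by blast
  qed
qed

lemma X_hh_letter: "x \<in> X_hh \<Longrightarrow> x k \<in> hh_alphabet"
  by (auto simp: X_hh_def)

lemma X_hh_toeplitz_pattern: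
  assumes "x \<in> X_hh" "finite P"
  obtains t where "\<And>p. p \<in> P \<Longrightarrow> p + t \<noteq> 0" "\<And>p. p \<in> P \<Longrightarrow> x p = toeplitz (p + t)"
  using assms unfolding X_hh_iff_toeplitz_patterns by blast

lemma fixed_point_in_X_hh:
  assumes "a \<in> hh_alphabet" shows "fixed_point a \<in> X_hh"
  unfolding X_hh_iff_toeplitz_patterns
proof (intro conjI allI impI)
  show "range (fixed_point a) \<subseteq> hh_alphabet" using assms by (auto simp: fixed_point_def)
  fix P :: "(int^2) set" assume "finite P"
  then obtain s where "\<And>p. p \<in> P \<Longrightarrow> p + s \<noteq> 0"
    "\<And>p. p \<in> P \<Longrightarrow> fixed_point a p = toeplitz (p + s)"
    using fixed_point_pattern[OF assms] by metis
  then show "\<exists>t. \<forall>p\<in>P. p + t \<noteq> 0 \<and> fixed_point a p = toeplitz (p + t)" by blast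
qed


section \<open>Addresses\<close>

text \<open>
  The residue of \<open>z\<close> modulo \<open>2 ^ n\<close> is the position of the point \<open>x\<close> relative to the hierarchy of
  sublattices \<open>2 ^ m\<close> with \<open>m \<le> n\<close>: the \<open>n\<close>-th level of the map from the subshift to its odometer
  factor.
\<close>

definition address :: "nat \<Rightarrow> (int^2 \<Rightarrow> nat) \<Rightarrow> int^2 \<Rightarrow> bool" where
  "address n x z \<longleftrightarrow> (\<forall>k. \<not> pow2_dvd n (k + z) \<longrightarrow> x k = toeplitz (k + z))"

lemma address_cong:
  assumes "address n x z" "pow2_dvd n (z - z')"
  shows "address n x z'"
  unfolding address_def
proof (intro allI impI)
  fix k assume k: "\<not> pow2_dvd n (k + z')"
  have "\<not> pow2_dvd n (k + z)"
    using k pow2_dvd_add_iff[OF assms(2), of "k + z'"] by (simp add: add.assoc)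
  then show "x k = toeplitz (k + z')"
    using assms toeplitz_cong[of n "k + z" "k + z'"] by (simp add: address_def)
qed

lemma address_unique:
  assumes "address n x z" "address n x z'"
  shows "pow2_dvd n (z - z')"
proof (rule ccontr)
  assume "\<not> pow2_dvd n (z - z')"
  then obtain k where "\<not> pow2_dvd n (k + z)" "\<not> pow2_dvd n (k + z')"
    "toeplitz (k + z) \<noteq> toeplitz (k + z')" by (rule toeplitz_separates)
  then show False using assms unfolding address_def by metis
qed

text \<open>
  By compactness: if each of the finitely many residues failed at some cell, these cells would
  form a finite pattern without a counterpart in \<open>toeplitz\<close>.
\<close>

lemma address_exists:
  assumes "x \<in> X_hh" obtains z where "address n x z"
proof (rule ccontr)
  assume no: "\<not> thesis"
  let ?B = "{z :: int^2. \<forall>i. 0 \<le> z $ i \<and> z $ i < 2 ^ n}"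
  have "\<exists>k. \<not> pow2_dvd n (k + z) \<and> x k \<noteq> toeplitz (k + z)" for z
    using no that unfolding address_def by blast
  then obtain f where f: "\<And>z. \<not> pow2_dvd n (f z + z) \<and> x (f z) \<noteq> toeplitz (f z + z)" by metis
  obtain t where t: "\<And>p. p \<in> f ` ?B \<Longrightarrow> x p = toeplitz (p + t)"
    using X_hh_toeplitz_pattern[OF assms, of "f ` ?B"] finite_box by blast
  obtain z where z: "z \<in> ?B" "pow2_dvd n (t - z)" by (rule bounded_representative)
  have d: "f z + z - (f z + t) = z - t" by simp
  have "toeplitz (f z + t) = toeplitz (f z + z)"
    using f[of z] z(2) pow2_dvd_diff[of n 0 "t - z"] by (intro toeplitz_cong) (auto simp: d)
  then show False using t[of "f z"] z(1) f[of z] by auto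
qed

text \<open>
  Addresses are locally constant: one cell separates \<open>z\<close> from each of the finitely many other residues.
\<close>

lemma address_window:
  assumes "address n x z"
  obtains P where "finite P" "\<And>y t. address n y t \<Longrightarrow> (\<And>p. p \<in> P \<Longrightarrow> y p = x p) \<Longrightarrow> pow2_dvd n (z - t)"
proof -
  let ?B = "{t :: int^2. \<forall>i. 0 \<le> t $ i \<and> t $ i < 2 ^ n}"
  have "\<exists>k. \<not> pow2_dvd n (z - t) \<longrightarrow> \<not> pow2_dvd n (k + z) \<and> \<not> pow2_dvd n (k + t) \<and>
    toeplitz (k + z) \<noteq> toeplitz (k + t)" for t
    using toeplitz_separates by metis
  then obtain f where f: "\<And>t. \<not> pow2_dvd n (z - t) \<Longrightarrow> \<not> pow2_dvd n (f t + z) \<and>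
      \<not> pow2_dvd n (f t + t) \<and> toeplitz (f t + z) \<noteq> toeplitz (f t + t)" by metis
  show ?thesis
  proof
    show "finite (f ` ?B)" by (simp add: finite_box)
    fix y t assume y: "address n y t" "\<And>p. p \<in> f ` ?B \<Longrightarrow> y p = x p"
    obtain t' where t': "t' \<in> ?B" "pow2_dvd n (t - t')" by (rule bounded_representative)
    have yt': "address n y t'" using y(1) t'(2) by (rule address_cong)
    have "y (f t') = x (f t')" using y(2) t'(1) by blast
    then have "pow2_dvd n (z - t')"
      using f[of t'] yt' assms unfolding address_def by metis
    then show "pow2_dvd n (z - t)" using pow2_dvd_diff[OF _ t'(2), of "z - t'"] by simp
  qed
qed

lemma address_shift: "address n x z \<Longrightarrow> address n (shift v x) (z + v)"
  by (simp add: address_def shift_def add_ac)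

lemma fixed_point_address: "address n (fixed_point a) 0"
  by (auto simp: address_def fixed_point_def)

text \<open>
  A fibre of the odometer factor with two points lies over an integer vector: a cell \<open>k\<close> where the two
  differ is left undetermined by every level, so the address is \<open>- k\<close> at every level.
\<close>

lemma disagreement_determines_address:
  assumes "\<And>n. address n x (z n)" "\<And>n. address n y (z n)" "x k \<noteq> y k"
  shows "pow2_dvd n (k + z n)"
  using assms(1)[of n] assms(2)[of n] assms(3) unfolding address_def by metis


section \<open>Affine symmetries\<close>

text \<open>
  This is the action of \<open>M\<close> modulo 2 on nonzero vectors, transported to the letters.
\<close>

definition letter_map :: "int^2^2 \<Rightarrow> nat \<Rightarrow> nat" where
  "letter_map M a = parity_letter (M *v letter_vec a)"

definition affine_map :: "int^2 \<Rightarrow> int^2^2 \<Rightarrow> (int^2 \<Rightarrow> nat) \<Rightarrow> int^2 \<Rightarrow> nat" where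
  "affine_map v M x = (\<lambda>k. letter_map M (x (matrix_inv M *v (v + k))))"

lemma letter_map_in_alphabet [simp]: "letter_map M a \<in> hh_alphabet"
  by (simp add: letter_map_def)

text \<open>
  A matrix in \<open>GL(2, \<int>)\<close> commutes with the extraction of the odd part, so it acts on the letters
  through its reduction modulo 2.
\<close>

lemma toeplitz_matrix:
  assumes "invertible M" "w \<noteq> 0"
  shows "toeplitz (M *v w) = letter_map M (toeplitz w)"
proof -
  obtain n where "\<not> pow2_dvd n w" using assms zero_if_all_pow2_dvd by blast
  then obtain m u where u: "w = 2 ^ m *s u" "\<not> pow2_dvd 1 u" by (rule odd_part_exists)
  define l where "l = letter_vec (parity_letter u)"
  have l: "\<not> pow2_dvd 1 l" by (simp add: l_def)
  have "parity_letter u = parity_letter l" by (simp add: l_def)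
  then have "pow2_dvd 1 (u - l)" using parity_letter_eq_iff[OF u(2) l] by simp
  then have "pow2_dvd 1 (M *v u - M *v l)"
    using pow2_dvd_matrix[of 1 "u - l" M] by (simp add: matrix_vector_mult_diff_distrib)
  then have "parity_letter (M *v u) = parity_letter (M *v l)"
    using u(2) l assms(1) by (subst parity_letter_eq_iff) auto
  moreover have "toeplitz (M *v w) = parity_letter (M *v u)"
    using u assms(1) by (simp add: matrix_vector_mult_scale toeplitz_scale_odd)
  moreover have "toeplitz w = parity_letter u" using u by (simp add: toeplitz_scale_odd)
  ultimately show ?thesis by (simp add: letter_map_def l_def)
qed

lemma letter_map_eq_toeplitz:
  "invertible M \<Longrightarrow> letter_map M a = toeplitz (M *v letter_vec a)"
  by (simp add: letter_map_def toeplitz_odd)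

lemma letter_map_compose:
  assumes "invertible M" "invertible M'"
  shows "letter_map M (letter_map M' a) = letter_map (M ** M') a"
proof -
  have "letter_vec a \<noteq> 0" using letter_vec_odd[of a] by (metis pow2_dvd_zero)
  then show ?thesis using assms
    by (simp add: letter_map_eq_toeplitz invertible_mult matrix_vector_mul_assoc[symmetric])
      (simp add: toeplitz_matrix letter_map_eq_toeplitz)
qed

lemma letter_map_one [simp]: "a \<in> hh_alphabet \<Longrightarrow> letter_map (mat 1) a = a"
  by (simp add: letter_map_def)

lemma affine_map_in_X_hh:
  assumes "invertible M" "x \<in> X_hh"
  shows "affine_map v M x \<in> X_hh"
  unfolding X_hh_iff_toeplitz_patterns
proof (intro conjI allI impI)
  show "range (affine_map v M x) \<subseteq> hh_alphabet" by (auto simp: affine_map_def)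
  fix P :: "(int^2) set" assume "finite P"
  then have "finite ((\<lambda>p. matrix_inv M *v (v + p)) ` P)" by simp
  then obtain t where t: "\<And>q. q \<in> (\<lambda>p. matrix_inv M *v (v + p)) ` P \<Longrightarrow> q + t \<noteq> 0"
    "\<And>q. q \<in> (\<lambda>p. matrix_inv M *v (v + p)) ` P \<Longrightarrow> x q = toeplitz (q + t)"
    using X_hh_toeplitz_pattern[OF assms(2)] by metis
  have "p + (v + M *v t) \<noteq> 0 \<and> affine_map v M x p = toeplitz (p + (v + M *v t))" if p: "p \<in> P" for p
  proof -
    define q where "q = matrix_inv M *v (v + p)"
    have q: "q + t \<noteq> 0" "x q = toeplitz (q + t)" using t[of q] p by (auto simp: q_def)
    have "M *v (q + t) = p + (v + M *v t)"
      using assms(1) by (simp add: q_def matrix_vector_right_distrib add_ac)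
    then show ?thesis
      using q toeplitz_matrix[OF assms(1) q(1)] matrix_eq_zero_iff[OF assms(1), of "q + t"]
      by (simp add: affine_map_def q_def)
  qed
  then show "\<exists>t. \<forall>p\<in>P. p + t \<noteq> 0 \<and> affine_map v M x p = toeplitz (p + t)" by blast
qed

lemma matrix_inv_mult_vector:
  fixes M M' :: "int^'d^'d"
  assumes "invertible M" "invertible M'"
  shows "matrix_inv (M ** M') *v w = matrix_inv M' *v (matrix_inv M *v w)"
proof -
  have "(M ** M') *v (matrix_inv M' *v (matrix_inv M *v w)) = w"
    using assms by (simp add: matrix_vector_mul_assoc[symmetric])
  then show ?thesis
    using matrix_inv_vector(2)[OF invertible_mult[OF assms]] by metis
qed

text \<open>
  This is the multiplication of the affine group, hence the semidirect product with respect to the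
  natural action of matrices on vectors.
\<close>

lemma affine_map_compose:
  assumes "invertible M" "invertible M'"
  shows "affine_map v M (affine_map v' M' x) = affine_map (v + M *v v') (M ** M') x"
proof
  fix k
  have "v' + matrix_inv M *v (v + k) = matrix_inv M *v (v + M *v v' + k)"
    using assms(1) by (simp add: matrix_vector_right_distrib)
  then show "affine_map v M (affine_map v' M' x) k = affine_map (v + M *v v') (M ** M') x k"
    using assms by (simp add: affine_map_def letter_map_compose matrix_inv_mult_vector)
qed

lemma invertible_mat_1 [simp]: "invertible (mat 1 :: 'a::semiring_1^'n^'n)"
  unfolding invertible_def by (metis matrix_mul_lid)

lemma invertible_matrix_inv:
  fixes M :: "'a::semiring_1^'n^'n"
  shows "invertible M \<Longrightarrow> invertible (matrix_inv M)"
  using matrix_inv_inverse unfolding invertible_def by blast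

lemma affine_map_one:
  assumes "x \<in> X_hh" shows "affine_map v (mat 1) x = shift v x"
proof -
  have "matrix_inv (mat 1 :: int^2^2) = mat 1"
    by (metis invertible_mat_1 matrix_inv_inverse(1) matrix_mul_lid)
  then show ?thesis using X_hh_letter[OF assms] by (auto simp: affine_map_def shift_def)
qed

lemma shift_in_X_hh: "x \<in> X_hh \<Longrightarrow> shift v x \<in> X_hh"
  using affine_map_in_X_hh[of "mat 1" x v] by (simp add: affine_map_one)

lemma affine_map_shift:
  assumes "invertible M"
  shows "affine_map v M (shift n x) = shift (M *v n) (affine_map v M x)"
proof
  fix k
  have "n + matrix_inv M *v (v + k) = matrix_inv M *v (v + (M *v n + k))"
    using assms by (simp add: matrix_vector_right_distrib)
  then show "affine_map v M (shift n x) k = shift (M *v n) (affine_map v M x) k"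
    by (simp add: affine_map_def shift_def)
qed

lemma affine_map_eq_shift: "affine_map v M x = shift v (affine_map 0 M x)"
  by (simp add: affine_map_def shift_def)

lemma affine_map_inverse:
  assumes "invertible M" "x \<in> X_hh"
  shows "affine_map v M (affine_map (- (matrix_inv M *v v)) (matrix_inv M) x) = x"
proof -
  have "M *v (- (matrix_inv M *v v)) = - v"
    using matrix_vector_mult_diff_distrib[of M 0 "matrix_inv M *v v"] assms(1) by simp
  then show ?thesis
    using assms matrix_inv_inverse[OF assms(1)]
    by (simp add: affine_map_compose invertible_matrix_inv affine_map_one shift_def)
qed

lemma continuous_affine_map:
  assumes "invertible M"
  shows "continuous_map hh_top hh_top (affine_map v M)"
proof -
  let ?A = "discrete_topology hh_alphabet"
  have "continuous_map hh_top ?A (\<lambda>x. affine_map v M x k)" for k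
  proof -
    have "continuous_map hh_top ?A (\<lambda>x. x (matrix_inv M *v (v + k)))"
      unfolding hh_top_def
      by (intro continuous_map_from_subtopology continuous_map_product_projection) simp
    then have "continuous_map hh_top ?A (letter_map M \<circ> (\<lambda>x. x (matrix_inv M *v (v + k))))"
      by (rule continuous_map_compose) auto
    then show ?thesis by (simp add: affine_map_def comp_def)
  qed
  then have "continuous_map hh_top (product_topology (\<lambda>_. ?A) UNIV) (affine_map v M)"
    by (simp add: continuous_map_componentwise_UNIV)
  then have "continuous_map hh_top (subtopology (product_topology (\<lambda>_. ?A) UNIV) X_hh) (affine_map v M)"
    by (rule continuous_map_into_subtopology) (use assms affine_map_in_X_hh in \<open>auto simp: topspace_hh_top\<close>)
  then show ?thesis by (simp flip: hh_top_def)
qed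

lemma M_endomorphism_affine_map:
  assumes "invertible M"
  shows "M_endomorphism hh_top shift M (restrict (affine_map v M) X_hh)"
  unfolding M_endomorphism_def topspace_hh_top
proof (intro conjI allI ballI)
  show "continuous_map hh_top hh_top (restrict (affine_map v M) X_hh)"
    by (rule continuous_map_eq[OF continuous_affine_map[OF assms]]) (simp add: topspace_hh_top)
  show "restrict (affine_map v M) X_hh ` X_hh = X_hh"
  proof (intro subset_antisym subsetI)
    fix x assume x: "x \<in> X_hh"
    let ?y = "affine_map (- (matrix_inv M *v v)) (matrix_inv M) x"
    have "?y \<in> X_hh" using x assms by (simp add: affine_map_in_X_hh invertible_matrix_inv)
    moreover have "restrict (affine_map v M) X_hh ?y = x"
      using x assms calculation by (simp add: affine_map_inverse)
    ultimately show "x \<in> restrict (affine_map v M) X_hh ` X_hh" by (metis image_eqI)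
  qed (use assms affine_map_in_X_hh in auto)
  fix n x assume "x \<in> X_hh"
  then show "restrict (affine_map v M) X_hh (shift n x) = shift (M *v n) (restrict (affine_map v M) X_hh x)"
    using assms by (simp add: affine_map_shift shift_in_X_hh)
qed simp


section \<open>Rigidity of endomorphisms\<close>

text \<open>
  In the product of discrete spaces, continuity at \<open>x\<close> says that each letter of the image is
  determined by a finite window of the argument.
\<close>

lemma continuous_map_hh_window:
  assumes "continuous_map hh_top hh_top \<phi>" "x \<in> X_hh"
  obtains P where "finite P" "\<And>y. y \<in> X_hh \<Longrightarrow> (\<And>p. p \<in> P \<Longrightarrow> y p = x p) \<Longrightarrow> \<phi> y k = \<phi> x k"
proof -
  let ?A = "discrete_topology hh_alphabet"
  let ?U = "{y \<in> topspace hh_top. \<phi> y k \<in> {\<phi> x k}}"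
  have "\<phi> x \<in> X_hh" using assms continuous_map_image_subset_topspace topspace_hh_top by blast
  then have letter: "\<phi> x k \<in> hh_alphabet" by (rule X_hh_letter)
  have "continuous_map hh_top ?A (\<lambda>x. x k)"
    unfolding hh_top_def by (intro continuous_map_from_subtopology continuous_map_product_projection) simp
  then have "continuous_map hh_top ?A (\<lambda>y. \<phi> y k)"
    using continuous_map_compose[OF assms(1)] by (auto simp: comp_def)
  then have "openin hh_top ?U"
    by (rule openin_continuous_map_preimage) (use letter in simp)
  then obtain T where T: "openin (product_topology (\<lambda>_. ?A) UNIV) T" "?U = T \<inter> X_hh"
    unfolding hh_top_def openin_subtopology by auto
  have "x \<in> T" using T(2) assms(2) by (auto simp: topspace_hh_top)
  then obtain V where V: "finite {i. V i \<noteq> hh_alphabet}" "x \<in> PiE UNIV V" "PiE UNIV V \<subseteq> T"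
    using T(1) unfolding openin_product_topology_alt by auto
  show ?thesis
  proof
    show "finite {i. V i \<noteq> hh_alphabet}" by (rule V)
    fix y assume y: "y \<in> X_hh" "\<And>p. p \<in> {i. V i \<noteq> hh_alphabet} \<Longrightarrow> y p = x p"
    have "y i \<in> V i" for i
      using y(2)[of i] V(2) X_hh_letter[OF y(1), of i] by (cases "V i = hh_alphabet") (auto simp: PiE_iff)
    then have "y \<in> ?U" unfolding T(2) using V(3) y(1) by auto
    then show "\<phi> y k = \<phi> x k" by simp
  qed
qed

text \<open>
  The approximating translate of a fixed point has its only exceptional cell at \<open>- t\<close>, which is kept out of
  the window \<open>P\<close>; so on \<open>P\<close> its letters are determined by its addresses.
\<close>

lemma fixed_point_orbit_dense:
  assumes "x \<in> X_hh" "finite P"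
  obtains t where "\<And>p. p \<in> P \<Longrightarrow> p + t \<noteq> 0" "\<And>p. p \<in> P \<Longrightarrow> shift t (fixed_point a) p = x p"
proof -
  obtain t where t: "\<And>p. p \<in> P \<Longrightarrow> p + t \<noteq> 0" "\<And>p. p \<in> P \<Longrightarrow> x p = toeplitz (p + t)"
    by (rule X_hh_toeplitz_pattern[OF assms]) blast
  have "shift t (fixed_point a) p = x p" if "p \<in> P" for p
    using t[OF that] by (simp add: shift_def fixed_point_def add.commute)
  with t(1) show ?thesis by (rule that)
qed

text \<open>
  The displacement of the address is locally constant and invariant under shifts. Hence its value at
  one point with a dense orbit, here a fixed point of the substitution, is its value everywhere.
\<close>

lemma endomorphism_translates_addresses:
  assumes "M_endomorphism hh_top shift (mat 1) \<phi>"
  shows "\<exists>d. \<forall>x\<in>X_hh. \<forall>z. address n x z \<longrightarrow> address n (\<phi> x) (z + d)"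
proof -
  have cont: "continuous_map hh_top hh_top \<phi>" and ran: "\<phi> ` X_hh = X_hh"
    and comm: "\<And>v x. x \<in> X_hh \<Longrightarrow> \<phi> (shift v x) = shift v (\<phi> x)"
    using assms by (auto simp: M_endomorphism_def topspace_hh_top)
  have y: "fixed_point 0 \<in> X_hh" by (simp add: fixed_point_in_X_hh)
  then have "\<phi> (fixed_point 0) \<in> X_hh" using ran by blast
  then obtain d where d: "address n (\<phi> (fixed_point 0)) d" by (rule address_exists)
  have "address n (\<phi> x) (z + d)" if x: "x \<in> X_hh" and z: "address n x z" for x z
    unfolding address_def
  proof (intro allI impI)
    fix k assume k: "\<not> pow2_dvd n (k + (z + d))"
    obtain P where P: "finite P" "\<And>y. y \<in> X_hh \<Longrightarrow> (\<And>p. p \<in> P \<Longrightarrow> y p = x p) \<Longrightarrow> \<phi> y k = \<phi> x k"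
      by (rule continuous_map_hh_window[OF cont x, where k = k]) blast
    obtain Q where Q: "finite Q"
      "\<And>y t. address n y t \<Longrightarrow> (\<And>p. p \<in> Q \<Longrightarrow> y p = x p) \<Longrightarrow> pow2_dvd n (z - t)"
      by (rule address_window[OF z]) blast
    have "finite (P \<union> Q)" using P(1) Q(1) by simp
    then obtain t where "\<And>p. p \<in> P \<union> Q \<Longrightarrow> p + t \<noteq> 0"
      and t: "\<And>p. p \<in> P \<union> Q \<Longrightarrow> shift t (fixed_point 0) p = x p"
      by (rule fixed_point_orbit_dense[OF x, where a = 0]) blast
    have "address n (shift t (fixed_point 0)) (0 + t)"
      by (rule address_shift[OF fixed_point_address])
    then have "pow2_dvd n (z - (0 + t))" using Q(2) t by blast
    then have zt: "pow2_dvd n (d + t - (z + d))" using pow2_dvd_diff[of n 0 "z - t"] by simp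
    have "address n (\<phi> (shift t (fixed_point 0))) (d + t)"
      using address_shift[OF d] comm[OF y] by simp
    then have "address n (\<phi> (shift t (fixed_point 0))) (z + d)" using zt by (rule address_cong)
    moreover have "\<phi> (shift t (fixed_point 0)) k = \<phi> x k"
      using P(2)[of "shift t (fixed_point 0)"] t shift_in_X_hh[OF y] by blast
    ultimately show "\<phi> x k = toeplitz (k + (z + d))" using k unfolding address_def by metis
  qed
  then show ?thesis by blast
qed

text \<open>
  Surjectivity is what makes the translation on the odometer integral: the fixed points of the
  substitution lie in one fibre, so distinct preimages of two of them lie in one fibre as well, and
  such a fibre has an integer address.
\<close>

theorem Id_endomorphism_is_shift:
  assumes "M_endomorphism hh_top shift (mat 1) \<phi>"
  obtains v where "\<And>x. x \<in> X_hh \<Longrightarrow> \<phi> x = shift v x"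
proof -
  have cont: "continuous_map hh_top hh_top \<phi>" and ran: "\<phi> ` X_hh = X_hh"
    using assms by (auto simp: M_endomorphism_def topspace_hh_top)
  obtain d where d: "\<And>n x z. x \<in> X_hh \<Longrightarrow> address n x z \<Longrightarrow> address n (\<phi> x) (z + d n)"
    using endomorphism_translates_addresses[OF assms] by metis
  have pre: "\<exists>x\<in>X_hh. \<phi> x = fixed_point a \<and> (\<forall>n. address n x (- d n))" if a: "a \<in> hh_alphabet" for a
  proof -
    obtain x where x: "x \<in> X_hh" "\<phi> x = fixed_point a"
      using ran fixed_point_in_X_hh[OF a] by (metis imageE)
    have "address n x (- d n)" for n
    proof -
      obtain z where z: "address n x z" by (rule address_exists[OF x(1)])
      have "pow2_dvd n (z + d n - 0)"
        using address_unique d[OF x(1) z] fixed_point_address unfolding x(2) by blast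
      then show ?thesis using address_cong[OF z, of "- d n"] by simp
    qed
    with x show ?thesis by blast
  qed
  \<comment> \<open>The cell where the two preimages differ is the shift vector.\<close>
  obtain x0 x1 where x01: "\<phi> x0 = fixed_point 0" "\<phi> x1 = fixed_point 1"
    "\<And>n. address n x0 (- d n)" "\<And>n. address n x1 (- d n)"
    using pre[OF zero_in_alphabet] pre[OF one_in_alphabet] by blast
  have "fixed_point 0 0 \<noteq> fixed_point 1 0" by (simp add: fixed_point_def)
  then have "x0 \<noteq> x1" using x01 by metis
  then obtain v where v: "x0 v \<noteq> x1 v" by blast
  have dv: "pow2_dvd n (v + - d n)" for n
    by (rule disagreement_determines_address[OF x01(3,4) v])
  have "\<phi> x = shift v x" if x: "x \<in> X_hh" for x
  proof
    fix j
    \<comment> \<open>Compare \<open>x\<close> with a point \<open>y\<close> of the dense orbit whose exceptional cell is not \<open>v + j\<close>, so that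
      the letter of \<open>\<phi> y\<close> at \<open>j\<close> can be read off its address.\<close>
    obtain P where P: "finite P" "\<And>y. y \<in> X_hh \<Longrightarrow> (\<And>p. p \<in> P \<Longrightarrow> y p = x p) \<Longrightarrow> \<phi> y j = \<phi> x j"
      by (rule continuous_map_hh_window[OF cont x, where k = j]) blast
    have "finite (insert (v + j) P)" using P(1) by simp
    then obtain t where t: "\<And>p. p \<in> insert (v + j) P \<Longrightarrow> p + t \<noteq> 0"
      "\<And>p. p \<in> insert (v + j) P \<Longrightarrow> shift t (fixed_point 0) p = x p"
      by (rule fixed_point_orbit_dense[OF x, where a = 0]) blast
    define y where "y = shift t (fixed_point 0)"
    have y: "y \<in> X_hh" unfolding y_def by (simp add: shift_in_X_hh fixed_point_in_X_hh)
    have "v + j + t \<noteq> 0" using t(1) by blast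
    then obtain n where n: "\<not> pow2_dvd n (v + j + t)" using zero_if_all_pow2_dvd by blast
    have yt: "address n y t" unfolding y_def using address_shift[OF fixed_point_address[of n 0], of t] by simp
    have "pow2_dvd n (t + d n - (t + v))" using dv[of n] pow2_dvd_diff[of n 0 "v + - d n"] by simp
    then have "address n (\<phi> y) (t + v)" using d[OF y yt] by (rule address_cong[rotated])
    then have "\<phi> y j = toeplitz (v + j + t)" using n by (simp add: address_def add_ac)
    also have "\<dots> = y (v + j)" using yt n by (simp add: address_def)
    also have "\<dots> = x (v + j)" unfolding y_def by (rule t(2)) simp
    finally show "\<phi> x j = shift v x j" using P(2)[OF y] t(2) by (simp add: y_def shift_def)
  qed
  then show ?thesis by (rule that)
qed

text \<open>
  Undoing the linear part by the symmetry for \<open>matrix_inv M\<close> leaves an \<open>Id\<close>-endomorphism.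
\<close>

lemma M_endomorphism_is_affine:
  assumes "invertible M" "M_endomorphism hh_top shift M \<phi>"
  obtains v where "\<phi> = restrict (affine_map v M) X_hh"
proof -
  have ext: "\<phi> \<in> extensional X_hh" and cont: "continuous_map hh_top hh_top \<phi>" and ran: "\<phi> ` X_hh = X_hh"
    and comm: "\<And>v x. x \<in> X_hh \<Longrightarrow> \<phi> (shift v x) = shift (M *v v) (\<phi> x)"
    using assms by (auto simp: M_endomorphism_def topspace_hh_top)
  let ?N = "matrix_inv M"
  define \<alpha> where "\<alpha> = affine_map 0 ?N"
  have N: "invertible ?N" using assms(1) by (rule invertible_matrix_inv)
  have \<alpha>: "continuous_map hh_top hh_top \<alpha>" "\<alpha> ` X_hh = X_hh"
    using continuous_affine_map[OF N, of 0] M_endomorphism_affine_map[OF N, of 0]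
    by (auto simp: \<alpha>_def M_endomorphism_def topspace_hh_top)
  have "M_endomorphism hh_top shift (mat 1) (restrict (\<alpha> \<circ> \<phi>) X_hh)"
    unfolding M_endomorphism_def topspace_hh_top
  proof (intro conjI allI ballI)
    show "continuous_map hh_top hh_top (restrict (\<alpha> \<circ> \<phi>) X_hh)"
      by (rule continuous_map_eq[OF continuous_map_compose[OF cont \<alpha>(1)]]) (simp add: topspace_hh_top)
    show "restrict (\<alpha> \<circ> \<phi>) X_hh ` X_hh = X_hh"
      using ran \<alpha>(2) by (simp flip: image_image)
    fix n x assume x: "x \<in> X_hh"
    then show "restrict (\<alpha> \<circ> \<phi>) X_hh (shift n x) = shift (mat 1 *v n) (restrict (\<alpha> \<circ> \<phi>) X_hh x)"
      using assms(1) N by (simp add: shift_in_X_hh comm \<alpha>_def affine_map_shift)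
  qed simp
  then obtain v where v: "\<And>x. x \<in> X_hh \<Longrightarrow> restrict (\<alpha> \<circ> \<phi>) X_hh x = shift v x"
    by (rule Id_endomorphism_is_shift) blast
  have "\<phi> x = affine_map (M *v v) M x" if x: "x \<in> X_hh" for x
  proof -
    have \<phi>x: "\<phi> x \<in> X_hh" using ran x by blast
    have "affine_map 0 M (\<alpha> (\<phi> x)) = \<phi> x"
      using affine_map_inverse[OF assms(1) \<phi>x, of 0] by (simp add: \<alpha>_def)
    moreover have "\<alpha> (\<phi> x) = affine_map v (mat 1) x" using v[OF x] x by (simp add: affine_map_one)
    ultimately show ?thesis using assms(1) by (simp add: affine_map_compose)
  qed
  then have "\<phi> = restrict (affine_map (M *v v) M) X_hh"
    using ext by (auto simp: extensional_def)
  then show ?thesis by (rule that)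
qed

lemma shift_free:
  assumes "x \<in> X_hh" "shift v x = shift w x"
  shows "v = w"
proof -
  have "pow2_dvd n (v - w)" for n
  proof -
    obtain z where "address n x z" by (rule address_exists[OF assms(1)])
    then have "pow2_dvd n (z + v - (z + w))"
      using address_shift address_unique assms(2) by metis
    then show ?thesis by simp
  qed
  then show ?thesis using zero_if_all_pow2_dvd[of "v - w"] by simp
qed

text \<open>
  Since the shift acts freely, the relation with the shift recovers \<open>M\<close>, and then the image of a
  single point recovers the translation.
\<close>

lemma affine_map_inject:
  assumes "invertible M" "invertible M'"
    "restrict (affine_map v M) X_hh = restrict (affine_map v' M') X_hh"
  shows "v = v'" "M = M'"
proof -
  define x where "x = fixed_point 0"
  have x: "x \<in> X_hh" by (simp add: x_def fixed_point_in_X_hh)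
  have eq: "affine_map v M y = affine_map v' M' y" if "y \<in> X_hh" for y
    using fun_cong[OF assms(3), of y] that by simp
  have "M *v n = M' *v n" for n
  proof -
    have "shift (M *v n) (affine_map v M x) = affine_map v M (shift n x)"
      using assms(1) by (simp add: affine_map_shift)
    also have "\<dots> = affine_map v' M' (shift n x)" by (rule eq) (rule shift_in_X_hh[OF x])
    also have "\<dots> = shift (M' *v n) (affine_map v M x)"
      using assms(2) eq[OF x] by (simp add: affine_map_shift)
    finally have "shift (M *v n) (affine_map v M x) = shift (M' *v n) (affine_map v M x)" .
    then show ?thesis using shift_free affine_map_in_X_hh assms(1) x by blast
  qed
  then show "M = M'" by (simp add: matrix_eq)
  then have "shift v (affine_map 0 M x) = shift v' (affine_map 0 M x)"
    using eq[OF x] affine_map_eq_shift by metis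
  then show "v = v'" using shift_free affine_map_in_X_hh assms(1) x by blast
qed


section \<open>Semidirect products\<close>

lemma group_semidirect_product:
  assumes "group G" "group H" "\<theta> \<in> hom H (AutoGroup G)"
  shows "group (semidirect_product G H \<theta>)"
proof -
  interpret G: group G by fact
  interpret H: group H by fact
  interpret \<theta>: group_hom H "AutoGroup G" \<theta>
    using assms G.AutoGroup by (simp add: group_hom_def group_hom_axioms_def)
  have aut: "\<theta> h \<in> hom G G" "\<theta> h \<in> Bij (carrier G)" if "h \<in> carrier H" for h
    using \<theta>.hom_closed[OF that] by (auto simp: AutoGroup_def auto_def)
  have closed: "\<theta> h g \<in> carrier G" if "h \<in> carrier H" "g \<in> carrier G" for h g
    using aut(1)[OF that(1)] that(2) by (rule hom_in_carrier)
  have act: "\<theta> (h \<otimes>\<^bsub>H\<^esub> h') g = \<theta> h (\<theta> h' g)"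
    if "h \<in> carrier H" "h' \<in> carrier H" "g \<in> carrier G" for h h' g
    using \<theta>.hom_mult[OF that(1,2)] aut(2) that
    by (simp add: AutoGroup_def BijGroup_def compose_def)
  have one: "\<theta> \<one>\<^bsub>H\<^esub> g = g" if "g \<in> carrier G" for g
    using \<theta>.hom_one that by (simp add: AutoGroup_def BijGroup_def)
  have mult: "\<theta> h (g \<otimes>\<^bsub>G\<^esub> g') = \<theta> h g \<otimes>\<^bsub>G\<^esub> \<theta> h g'"
    if "h \<in> carrier H" "g \<in> carrier G" "g' \<in> carrier G" for h g g'
    using aut(1)[OF that(1)] that by (simp add: hom_def)
  have unit: "\<theta> h \<one>\<^bsub>G\<^esub> = \<one>\<^bsub>G\<^esub>" if "h \<in> carrier H" for h
    using hom_one[OF aut(1)[OF that] assms(1,1)] .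
  show ?thesis
  proof (rule groupI)
    fix x y z assume "x \<in> carrier (semidirect_product G H \<theta>)" "y \<in> carrier (semidirect_product G H \<theta>)"
      "z \<in> carrier (semidirect_product G H \<theta>)"
    then show "x \<otimes>\<^bsub>semidirect_product G H \<theta>\<^esub> y \<otimes>\<^bsub>semidirect_product G H \<theta>\<^esub> z =
      x \<otimes>\<^bsub>semidirect_product G H \<theta>\<^esub> (y \<otimes>\<^bsub>semidirect_product G H \<theta>\<^esub> z)"
      by (auto simp: semidirect_product_def mult act closed G.m_assoc H.m_assoc simp del: \<theta>.hom_mult)
  next
    fix x assume "x \<in> carrier (semidirect_product G H \<theta>)"
    then obtain g h where x: "x = (g, h)" "g \<in> carrier G" "h \<in> carrier H"
      by (auto simp: semidirect_product_def)
    let ?y = "(\<theta> (inv\<^bsub>H\<^esub> h) (inv\<^bsub>G\<^esub> g), inv\<^bsub>H\<^esub> h)"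
    have "?y \<in> carrier (semidirect_product G H \<theta>)"
      "?y \<otimes>\<^bsub>semidirect_product G H \<theta>\<^esub> x = \<one>\<^bsub>semidirect_product G H \<theta>\<^esub>"
      using x by (auto simp: semidirect_product_def closed unit simp flip: mult simp del: \<theta>.hom_inv)
    then show "\<exists>y\<in>carrier (semidirect_product G H \<theta>).
      y \<otimes>\<^bsub>semidirect_product G H \<theta>\<^esub> x = \<one>\<^bsub>semidirect_product G H \<theta>\<^esub>" by blast
  qed (auto simp: semidirect_product_def closed one simp del: \<theta>.hom_one)
qed

lemma group_int_vec_group: "group (int_vec_group :: (int^'d) monoid)"
  by (rule groupI) (auto simp: int_vec_group_def add.assoc intro: exI[of _ "- x" for x])

lemma group_GL_int: "group (GL_int :: (int^'d^'d) monoid)"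
proof (rule groupI)
  fix M :: "int^'d^'d" assume "M \<in> carrier GL_int"
  then show "\<exists>N\<in>carrier GL_int. N \<otimes>\<^bsub>GL_int\<^esub> M = \<one>\<^bsub>GL_int\<^esub>"
    by (auto simp: GL_int_def matrix_inv_inverse intro!: exI[of _ "matrix_inv M"] invertible_matrix_inv)
qed (auto simp: GL_int_def invertible_mult matrix_mul_assoc)

lemma GL_int_action:
  "(\<lambda>M. (*v) M) \<in> hom (GL_int :: (int^'d^'d) monoid) (AutoGroup int_vec_group)"
proof -
  have bij: "(*v) M \<in> Bij UNIV" if "invertible M" for M :: "int^'d^'d"
    using matrix_inv_vector[OF that]
    by (auto simp: Bij_def intro!: bij_betw_byWitness[where f' = "(*v) (matrix_inv M)"])
  have "(*v) M \<in> carrier (AutoGroup int_vec_group)" if "invertible M" for M :: "int^'d^'d"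
    using bij[OF that]
    by (auto simp: AutoGroup_def auto_def hom_def int_vec_group_def matrix_vector_right_distrib)
  moreover have "(*v) (M ** N) = (*v) M \<otimes>\<^bsub>AutoGroup int_vec_group\<^esub> (*v) N"
    if "invertible M" "invertible N" for M N :: "int^'d^'d"
    using bij[OF that(1)] bij[OF that(2)]
    by (simp add: AutoGroup_def BijGroup_def int_vec_group_def compose_def fun_eq_iff matrix_vector_mul_assoc)
  ultimately show ?thesis by (auto simp: hom_def GL_int_def)
qed


section \<open>The normalizer\<close>

lemma affine_iso:
  "(\<lambda>(v, M). restrict (affine_map v M) X_hh) \<in>
     iso (semidirect_product (int_vec_group :: (int^2) monoid) GL_int (\<lambda>M. (*v) M))
       (normalizer_semigroup hh_top shift)" (is "?f \<in> iso ?S ?N")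
proof (rule isoI)
  have S: "carrier ?S = {(v, M). invertible M}"
    by (auto simp: semidirect_product_def int_vec_group_def GL_int_def)
  have N: "carrier ?N = {\<phi>. \<exists>M. invertible M \<and> M_endomorphism hh_top shift M \<phi>}"
    by (simp add: normalizer_semigroup_def)
  show "?f \<in> hom ?S ?N"
  proof (rule homI)
    fix p assume "p \<in> carrier ?S"
    then show "?f p \<in> carrier ?N" unfolding S N using M_endomorphism_affine_map by auto
  next
    fix p q assume pq: "p \<in> carrier ?S" "q \<in> carrier ?S"
    obtain v M w K where [simp]: "p = (v, M)" "q = (w, K)" by (cases p, cases q)
    have inv: "invertible M" "invertible K" using pq unfolding S by auto
    have "compose X_hh (restrict (affine_map v M) X_hh) (restrict (affine_map w K) X_hh) =
        restrict (affine_map (v + M *v w) (M ** K)) X_hh"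
      using inv by (auto simp: compose_def restrict_def fun_eq_iff affine_map_in_X_hh affine_map_compose)
    then show "?f (p \<otimes>\<^bsub>?S\<^esub> q) = ?f p \<otimes>\<^bsub>?N\<^esub> ?f q"
      by (simp add: semidirect_product_def int_vec_group_def GL_int_def normalizer_semigroup_def topspace_hh_top)
  qed
  show "bij_betw ?f (carrier ?S) (carrier ?N)"
  proof (rule bij_betw_imageI)
    show "inj_on ?f (carrier ?S)"
      unfolding S by (rule inj_onI) (auto dest: affine_map_inject)
    show "?f ` carrier ?S = carrier ?N"
    proof (intro subset_antisym subsetI)
      fix \<phi> assume "\<phi> \<in> ?f ` carrier ?S"
      then show "\<phi> \<in> carrier ?N" unfolding S N using M_endomorphism_affine_map by auto
    next
      fix \<phi> assume "\<phi> \<in> carrier ?N"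
      then obtain M where M: "invertible M" "M_endomorphism hh_top shift M \<phi>" unfolding N by blast
      then obtain v where "\<phi> = restrict (affine_map v M) X_hh" by (rule M_endomorphism_is_affine)
      then show "\<phi> \<in> ?f ` carrier ?S" unfolding S using M(1) by (auto intro!: image_eqI[of _ _ "(v, M)"])
    qed
  qed
qed

lemma restrict_shift_eq_affine_map: "restrict (shift v) X_hh = restrict (affine_map v (mat 1)) X_hh"
  by (rule restrict_ext) (simp add: affine_map_one)

lemma system_automorphisms_hh:
  "system_automorphisms hh_top shift = {restrict (shift v) X_hh | v. True}"
proof (intro subset_antisym subsetI)
  fix \<phi> assume "\<phi> \<in> system_automorphisms hh_top shift"
  then have "M_endomorphism hh_top shift (mat 1) \<phi>" by (simp add: system_automorphisms_def)
  then obtain v where "\<phi> = restrict (affine_map v (mat 1)) X_hh"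
    by (rule M_endomorphism_is_affine[OF invertible_mat_1])
  then show "\<phi> \<in> {restrict (shift v) X_hh | v. True}"
    unfolding restrict_shift_eq_affine_map by blast
next
  fix \<phi> assume "\<phi> \<in> {restrict (shift v) X_hh | v. True}"
  then obtain v where \<phi>: "\<phi> = restrict (shift v) X_hh" by blast
  have endo: "M_endomorphism hh_top shift (mat 1) (restrict (shift w) X_hh)" for w
    unfolding restrict_shift_eq_affine_map by (rule M_endomorphism_affine_map) simp
  have inverse: "compose X_hh (restrict (shift (- w)) X_hh) (restrict (shift w) X_hh) = (\<lambda>x\<in>X_hh. x)" for w
    by (auto simp: compose_def restrict_def fun_eq_iff shift_in_X_hh) (simp add: shift_def)
  show "\<phi> \<in> system_automorphisms hh_top shift"
    unfolding \<phi> system_automorphisms_def topspace_hh_top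
    using endo[of v] endo[of "- v"] inverse[of v] inverse[of "- v"] by auto
qed

theorem corollary4p8:
  shows "group (normalizer_semigroup hh_top shift) \<and>
    (\<exists>\<theta> \<in> hom (GL_int :: (int^2^2) monoid) (AutoGroup (int_vec_group :: (int^2) monoid)).
       normalizer_semigroup hh_top shift \<cong>
         semidirect_product (int_vec_group :: (int^2) monoid) (GL_int :: (int^2^2) monoid) \<theta>) \<and>
    system_automorphisms hh_top shift = {restrict (shift n) X_hh | n. True}"
proof (intro conjI bexI)
  let ?S = "semidirect_product (int_vec_group :: (int^2) monoid) (GL_int :: (int^2^2) monoid) (\<lambda>M. (*v) M)"
  let ?N = "normalizer_semigroup hh_top shift"
  let ?f = "\<lambda>(v, M). restrict (affine_map v M) X_hh"
  interpret S: group ?S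
    by (rule group_semidirect_product[OF group_int_vec_group group_GL_int GL_int_action])
  have "?f \<one>\<^bsub>?S\<^esub> = restrict (shift 0) X_hh"
    by (simp add: semidirect_product_def int_vec_group_def GL_int_def restrict_shift_eq_affine_map)
  also have "\<dots> = \<one>\<^bsub>?N\<^esub>"
    by (auto simp: normalizer_semigroup_def topspace_hh_top shift_def restrict_def fun_eq_iff)
  finally have "?f \<one>\<^bsub>?S\<^esub> = \<one>\<^bsub>?N\<^esub>" .
  then show "group ?N" using S.iso_imp_img_group[OF affine_iso] by simp
  show "?N \<cong> ?S" using S.iso_sym affine_iso unfolding is_iso_def by blast
  show "(\<lambda>M. (*v) M) \<in> hom (GL_int :: (int^2^2) monoid) (AutoGroup (int_vec_group :: (int^2) monoid))"
    by (rule GL_int_action)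
  show "system_automorphisms hh_top shift = {restrict (shift n) X_hh | n. True}"
    by (rule system_automorphisms_hh)
qed

end
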